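(* For any $n \in \mathbb{N} \setminus \{1\}$, there exists a graph $G$ on $\Theta(n)$ vertices such that $\mathrm{eq}(G) = \Omega(n)$ and $\mathrm{pq}(G) = O(\log n)$.
   Context: Query game on a simple graph $G=(V,E)$: $d_G(u,v)$ denotes the graph distance. An adversary fixes a target vertex $v^*\in V$ unknown to an adaptive algorithm. In each round the algorithm queries two vertices $u,v$, and the adversary replies with whichever of $u,v$ is closer to $v^*$ (with either one, at the adversary's choice, if $d_G(u,v^* )=d_G(v,v^* )$). Equivalently: put $V_0=V$; in round $t$ the algorithm presents $(u_t,v_t)$ (depending on $G$ and earlier replies) and the adversary chooses either $V_t=\{x\in V_{t-1}: d_G(u_t,x)\le d_G(v_t,x)\}$ (reply $u_t$) or $V_t=\{x\in V_{t-1}: d_G(v_t,x)\le d_G(u_t,x)\}$ (reply $v_t$); the target is located once $|V_t|=1$. A pair query allows arbitrary $u,v\in V$; an edge query requires $u$ and $v$ to be adjacent. $\mathrm{pq}(G)$ (respectively $\mathrm{eq}(G)$) is the least integer $t$ such that the algorithm can locate the target in at most $t$ pair queries (respectively edge queries), regardless of the strategy of the adversary. $\mathbb{N}=\{1,2,\dots\}$; the constants hidden in $\Theta(\cdot)$, $\Omega(\cdot)$, $O(\cdot)$ are absolute (positive and independent of $n$). *)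

theory Defs
  imports Complex_Main "Graph_Theory.Graph_Theory"
begin

text \<open>
  A finite simple graph is a symmetric digraph without loops and parallel arcs: the locale
  \<open>graph\<close>. The graph distance is the shortest-path distance for unit arc weights; it is
  extended-real-valued only because \<open>wf_digraph.\<mu>\<close> is (no walk means distance \<open>\<infinity>\<close>).
\<close>

definition gdist :: "('a, 'b) pre_digraph \<Rightarrow> 'a \<Rightarrow> 'a \<Rightarrow> ereal" where
  "gdist G u v = wf_digraph.\<mu> G (\<lambda>_. 1) u v"

definition truthful_reply :: "('a, 'b) pre_digraph \<Rightarrow> 'a \<Rightarrow> 'a \<times> 'a \<Rightarrow> 'a \<Rightarrow> bool" where
  "truthful_reply G x q r \<longleftrightarrow>
     (r = fst q \<and> gdist G (fst q) x \<le> gdist G (snd q) x) \<or>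
     (r = snd q \<and> gdist G (snd q) x \<le> gdist G (fst q) x)"

text \<open>
  An adaptive algorithm maps the list of the replies received so far (oldest first) to the next
  query.
\<close>

type_synonym 'a strategy = "'a list \<Rightarrow> 'a \<times> 'a"

definition truthful_replies ::
    "('a, 'b) pre_digraph \<Rightarrow> 'a strategy \<Rightarrow> 'a \<Rightarrow> 'a list \<Rightarrow> bool" where
  "truthful_replies G \<sigma> x rs \<longleftrightarrow>
     (\<forall>i < length rs. truthful_reply G x (\<sigma> (take i rs)) (rs ! i))"

text \<open>The set $V_t$ of the vertices compatible with the first $t$ replies.\<close>

definition candidates :: "('a, 'b) pre_digraph \<Rightarrow> 'a strategy \<Rightarrow> 'a list \<Rightarrow> 'a set" where
  "candidates G \<sigma> rs = {x \<in> verts G. truthful_replies G \<sigma> x rs}"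

text \<open>
  Since replies must be truthful for some target, the adversary can never make the candidate set
  empty. Legality is only required of the first \<open>t\<close> queries, so that \<open>t = 0\<close> is
  possible for a one-vertex graph even though it has no edge to query.
\<close>

definition locates ::
    "('a, 'b) pre_digraph \<Rightarrow> ('a \<times> 'a) set \<Rightarrow> 'a strategy \<Rightarrow> nat \<Rightarrow> bool" where
  "locates G Q \<sigma> t \<longleftrightarrow>
     (\<forall>rs. length rs < t \<longrightarrow> \<sigma> rs \<in> Q) \<and>
     (\<forall>target \<in> verts G. \<forall>rs. length rs = t \<and> truthful_replies G \<sigma> target rs \<longrightarrow>
        (\<exists>s \<le> t. card (candidates G \<sigma> (take s rs)) = 1))"

text \<open>
  For a finite nonempty connected graph both minima below exist: if \<open>x \<noteq> y\<close> are candidates and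
  \<open>x'\<close> is the neighbour of \<open>x\<close> on a shortest path to \<open>y\<close>, then either reply to the
  query \<open>(x, x')\<close> eliminates \<open>x\<close> or \<open>y\<close>.
\<close>

definition pq :: "('a, 'b) pre_digraph \<Rightarrow> nat" where
  "pq G = (LEAST t. \<exists>\<sigma>. locates G (verts G \<times> verts G) \<sigma> t)"

definition eq :: "('a, 'b) pre_digraph \<Rightarrow> nat" where
  "eq G = (LEAST t. \<exists>\<sigma>. locates G (arcs_ends G) \<sigma> t)"

end

(*
  Take a hub adjacent to every vertex, n independent vertices 0, ..., n - 1 and, for each of about
  log n bit positions i, two selectors a(i,0) and a(i,1), where a(i,c) is adjacent to the x < n
  whose i-th bit is c.  All distances are at most 2.  The reply "hub" to an edge (hub, v) eliminates
  no x < n except possibly v, and the reply "a(i,c)" to an edge (a(i,c), x) eliminates only x among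
  0, ..., n - 1, since these are pairwise at distance 2; so edge queries eliminate them one at a time.
  The pair query (a(i,0), a(i,1)) on the other hand reads off the i-th bit of the target.  After these
  queries only one x < n and the O(log n) remaining vertices are candidates, and querying two
  candidates always eliminates the one that is not the reply.
*)

theory Submission
  imports Defs
begin

section \<open>Locating strategies\<close>

lemma truthful_replies_Nil: "truthful_replies G \<sigma> x []"
  by (simp add: truthful_replies_def)

lemma truthful_replies_snoc:
  "truthful_replies G \<sigma> x (rs @ [r]) \<longleftrightarrow>
     truthful_replies G \<sigma> x rs \<and> truthful_reply G x (\<sigma> rs) r"
proof -
  have "truthful_replies G \<sigma> x (rs @ [r]) \<longleftrightarrow>
    (\<forall>i < length rs. truthful_reply G x (\<sigma> (take i (rs @ [r]))) ((rs @ [r]) ! i)) \<and>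
    truthful_reply G x (\<sigma> rs) r"
    unfolding truthful_replies_def by (auto simp: less_Suc_eq)
  then show ?thesis by (simp add: truthful_replies_def nth_append)
qed

lemma truthful_replies_take:
  "truthful_replies G \<sigma> x rs \<Longrightarrow> truthful_replies G \<sigma> x (take s rs)"
  by (auto simp: truthful_replies_def min_def split: if_splits)

text \<open>The adversary always gives the reply that contradicts at most one element of
  \<open>Y\<close>, so at least \<open>card Y - s\<close> of them survive \<open>s\<close>
  queries.\<close>

lemma locates_imp_card_le:
  assumes loc: "locates G Q \<sigma> t"
    and Y: "Y \<subseteq> verts G" and fin: "finite (verts G)"
    and adversary: "\<And>q. q \<in> Q \<Longrightarrow> \<exists>r. card {y \<in> Y. \<not> truthful_reply G y q r} \<le> 1"
  shows "card Y \<le> t + 1"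
proof (rule ccontr)
  assume "\<not> card Y \<le> t + 1"
  then have big: "card Y \<ge> t + 2" by simp
  have finY: "finite Y" using Y fin finite_subset by blast
  have "\<exists>rs. length rs = s \<and> card Y \<le> card {y \<in> Y. truthful_replies G \<sigma> y rs} + s"
    if "s \<le> t" for s
    using that
  proof (induction s)
    case 0
    show ?case by (intro exI[of _ "[]"]) (simp add: truthful_replies_Nil)
  next
    case (Suc s)
    then obtain rs where len: "length rs = s"
      and card: "card Y \<le> card {y \<in> Y. truthful_replies G \<sigma> y rs} + s" by auto
    from loc len Suc.prems have "\<sigma> rs \<in> Q" by (auto simp: locates_def)
    from adversary[OF this] obtain r
      where r: "card {y \<in> Y. \<not> truthful_reply G y (\<sigma> rs) r} \<le> 1" by auto
    have "card {y \<in> Y. truthful_replies G \<sigma> y rs}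
        \<le> card ({y \<in> Y. truthful_replies G \<sigma> y (rs @ [r])} \<union>
              {y \<in> Y. \<not> truthful_reply G y (\<sigma> rs) r})"
      by (rule card_mono) (use finY in \<open>auto simp: truthful_replies_snoc\<close>)
    also have "\<dots> \<le> card {y \<in> Y. truthful_replies G \<sigma> y (rs @ [r])} +
        card {y \<in> Y. \<not> truthful_reply G y (\<sigma> rs) r}"
      by (rule card_Un_le)
    finally show ?case using card r len by (intro exI[of _ "rs @ [r]"]) simp
  qed
  from this[of t] obtain rs where len: "length rs = t"
    and card: "card Y \<le> card {y \<in> Y. truthful_replies G \<sigma> y rs} + t" by auto
  from card big have two: "card {y \<in> Y. truthful_replies G \<sigma> y rs} \<ge> 2" by simp
  then have "{y \<in> Y. truthful_replies G \<sigma> y rs} \<noteq> {}" by (intro notI) simp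
  then obtain y where "y \<in> Y" "truthful_replies G \<sigma> y rs" by blast
  with loc len Y obtain s where s: "card (candidates G \<sigma> (take s rs)) = 1"
    unfolding locates_def by blast
  \<comment> \<open>A shorter reply list constrains less, so two survivors after \<open>t\<close>
    replies rule out a singleton at every earlier time \<open>s\<close>.\<close>
  have "card {y \<in> Y. truthful_replies G \<sigma> y rs} \<le> card (candidates G \<sigma> (take s rs))"
    by (rule card_mono) (use Y fin in \<open>auto simp: candidates_def truthful_replies_take\<close>)
  with two s show False by simp
qed

text \<open>A truthful reply list always keeps its target as a candidate, so "at most one" suffices,
  and reply lists without candidates need no attention.\<close>

lemma locatesI_unique:
  assumes legal: "\<And>rs. length rs < t \<Longrightarrow> \<sigma> rs \<in> Q"
    and unique: "\<And>rs x y. \<lbrakk>length rs = t; x \<in> candidates G \<sigma> rs; y \<in> candidates G \<sigma> rs\<rbrakk> \<Longrightarrow> x = y"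
  shows "locates G Q \<sigma> t"
  unfolding locates_def
proof (intro conjI allI impI ballI)
  fix x rs assume x: "x \<in> verts G" and rs: "length rs = t \<and> truthful_replies G \<sigma> x rs"
  then have "x \<in> candidates G \<sigma> rs" by (simp add: candidates_def)
  with unique rs have "candidates G \<sigma> rs = {x}" by blast
  then have "card (candidates G \<sigma> (take t rs)) = 1" using rs by simp
  then show "\<exists>s\<le>t. card (candidates G \<sigma> (take s rs)) = 1" by blast
qed (use legal in auto)

lemma ex_locates_if_separating:
  assumes fin: "finite Q"
    and separating: "\<And>x y. \<lbrakk>x \<in> verts G; y \<in> verts G; x \<noteq> y\<rbrakk> \<Longrightarrow>
      \<exists>q \<in> Q. \<forall>r. \<not> (truthful_reply G x q r \<and> truthful_reply G y q r)"
  shows "\<exists>\<sigma> t. locates G Q \<sigma> t"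
proof -
  obtain qs where qs: "set qs = Q" using fin finite_list by blast
  define \<sigma> where "\<sigma> = (\<lambda>rs :: 'a list. qs ! length rs)"
  have "locates G Q \<sigma> (length qs)"
  proof (rule locatesI_unique)
    fix rs :: "'a list" and x y
    assume len: "length rs = length qs"
      and cand: "x \<in> candidates G \<sigma> rs" "y \<in> candidates G \<sigma> rs"
    show "x = y"
    proof (rule ccontr)
      assume "x \<noteq> y"
      with cand separating obtain q where "q \<in> Q"
        and q: "\<And>r. \<not> (truthful_reply G x q r \<and> truthful_reply G y q r)"
        unfolding candidates_def by blast
      then obtain i where i: "i < length qs" "qs ! i = q" using qs by (metis in_set_conv_nth)
      then have "\<sigma> (take i rs) = q" using len by (simp add: \<sigma>_def)
      with i cand len have "truthful_reply G x q (rs ! i)" "truthful_reply G y q (rs ! i)"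
        unfolding candidates_def truthful_replies_def by fastforce+
      with q show False by blast
    qed
  qed (use qs in \<open>auto simp: \<sigma>_def\<close>)
  then show ?thesis by blast
qed

section \<open>Graphs with a dominating vertex\<close>

text \<open>The detour through \<open>h\<close> bounds every distance by 2, so comparing distances
  reduces to adjacency.\<close>

lemma gdist_hub:
  assumes wf: "wf_digraph G"
    and hub: "\<And>u. \<lbrakk>u \<in> verts G; u \<noteq> h\<rbrakk> \<Longrightarrow> (u, h) \<in> arcs_ends G \<and> (h, u) \<in> arcs_ends G"
    and uv: "u \<in> verts G" "v \<in> verts G"
  shows "gdist G u v = (if u = v then 0 else if (u, v) \<in> arcs_ends G then 1 else 2)"
proof -
  interpret wf_digraph G by (rule wf)
  have cost: "awalk_cost (\<lambda>_. 1) p = real (length p)" for p :: "'b list"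
    by (induction p) simp_all
  have upper: "gdist G u v \<le> ereal (real (length p))" if "awalk u p v" for p
    using min_cost_le_walk_cost[OF that, of "\<lambda>_. 1"] by (simp add: gdist_def cost)
  have lower: "ereal c \<le> gdist G u v" if "\<And>p. awalk u p v \<Longrightarrow> c \<le> real (length p)" for c
    unfolding gdist_def \<mu>_def using that by (auto simp: cost intro!: INF_greatest)
  have long: "1 \<le> length p" if "awalk u p v" "u \<noteq> v" for p
    using that by (cases p) (auto simp: awalk_Nil_iff)
  have longer: "2 \<le> length p" if "awalk u p v" "u \<noteq> v" "(u, v) \<notin> arcs_ends G" for p
    using that
    \<comment> \<open>The rule serves only to split into the empty list, one-element lists and
      longer lists.\<close>
    by (cases p rule: remdups_adj.cases)
      (auto simp: awalk_Nil_iff awalk_Cons_iff arcs_ends_conv image_iff)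
  have arc: "\<exists>p. awalk a p b \<and> length p = 1" if "(a, b) \<in> arcs_ends G" for a b
  proof -
    from that obtain e where "e \<in> arcs G" "tail G e = a" "head G e = b"
      by (auto simp: arcs_ends_conv)
    then have "awalk a [e] b" by (auto simp: awalk_Cons_iff awalk_Nil_iff)
    then show ?thesis by force
  qed
  consider "u = v" | "u \<noteq> v" "(u, v) \<in> arcs_ends G" | "u \<noteq> v" "(u, v) \<notin> arcs_ends G" by blast
  then show ?thesis
  proof cases
    case 1
    have "gdist G u v \<le> 0" using upper[of "[]"] 1 uv by (simp add: awalk_Nil_iff zero_ereal_def)
    moreover have "0 \<le> gdist G u v" using lower[of 0] by (simp add: zero_ereal_def)
    ultimately show ?thesis using 1 by simp
  next
    case 2
    obtain p where "awalk u p v" "length p = 1" using arc 2 by blast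
    then have "gdist G u v \<le> 1" using upper by (force simp: one_ereal_def)
    moreover have "1 \<le> gdist G u v" using lower[of 1] long 2 by (force simp: one_ereal_def)
    ultimately show ?thesis using 2 by simp
  next
    case 3
    then have "u \<noteq> h" "v \<noteq> h" using hub uv by blast+
    then obtain p q where "awalk u p h" "length p = 1" "awalk h q v" "length q = 1"
      using arc hub uv by meson
    then have "awalk u (p @ q) v" "length (p @ q) = 2" by (auto intro: awalk_appendI)
    then have "gdist G u v \<le> 2" using upper by (metis numeral_eq_ereal of_nat_numeral)
    moreover have "2 \<le> gdist G u v" using lower[of 2] longer 3 by fastforce
    ultimately show ?thesis using 3 by simp
  qed
qed

lemma connected_hub:
  assumes wf: "wf_digraph G" and h: "h \<in> verts G"
    and hub: "\<And>u. \<lbrakk>u \<in> verts G; u \<noteq> h\<rbrakk> \<Longrightarrow> (u, h) \<in> arcs_ends G \<and> (h, u) \<in> arcs_ends G"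
  shows "connected G"
proof -
  interpret wf_digraph G by (rule wf)
  show ?thesis
    unfolding connected_def
  proof (rule strongly_connectedI)
    fix u v assume "u \<in> verts (mk_symmetric G)" "v \<in> verts (mk_symmetric G)"
    then have "u \<in> verts G" "v \<in> verts G" by simp_all
    then have "u \<rightarrow>\<^sup>*\<^bsub>G\<^esub> h" "h \<rightarrow>\<^sup>*\<^bsub>G\<^esub> v"
      using hub h by (metis reachable_adjI reachable_refl)+
    then have "u \<rightarrow>\<^sup>*\<^bsub>G\<^esub> v" by (rule reachable_trans)
    then show "u \<rightarrow>\<^sup>*\<^bsub>mk_symmetric G\<^esub> v" by (rule reachable_mk_symmetricI)
  qed (use h in auto)
qed

section \<open>The selector graph\<close>

text \<open>Vertices below \<open>n\<close> are the independent ones and \<open>n\<close> is the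
  hub; the selectors of the first \<open>k\<close> bits fill \<open>n + 1\<close> to
  \<open>n + 2 * k\<close> without gaps.\<close>

definition selector :: "nat \<Rightarrow> nat \<Rightarrow> bool \<Rightarrow> nat" where
  "selector n i c = Suc n + 2 * i + of_bool c"

text \<open>The position \<open>i\<close> is unbounded here; the vertex bound of
  \<open>selector_graph\<close> cuts it off at \<open>k\<close>.\<close>

definition selects :: "nat \<Rightarrow> nat \<Rightarrow> nat \<Rightarrow> bool" where
  "selects n v x \<longleftrightarrow> x < n \<and> (\<exists>i. v = selector n i (bit x i))"

definition selector_adj :: "nat \<Rightarrow> nat \<Rightarrow> nat \<Rightarrow> bool" where
  "selector_adj n u v \<longleftrightarrow> u \<noteq> v \<and> (u = n \<or> v = n \<or> selects n u v \<or> selects n v u)"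

definition selector_graph :: "nat \<Rightarrow> nat \<Rightarrow> (nat, nat \<times> nat) pre_digraph" where
  "selector_graph n k =
     \<lparr>verts = {..<Suc (n + 2 * k)},
      arcs = {(u, v). u < Suc (n + 2 * k) \<and> v < Suc (n + 2 * k) \<and> selector_adj n u v},
      tail = fst, head = snd\<rparr>"

lemma selector_eq_iff: "selector n i c = selector n j d \<longleftrightarrow> i = j \<and> c = d"
  unfolding selector_def of_bool_def by (cases c; cases d) (simp_all, presburger+)

lemma selector_gt: "selector n i c > n"
  by (simp add: selector_def)

lemma selector_less: "i < k \<Longrightarrow> selector n i c < Suc (n + 2 * k)"
  by (auto simp: selector_def of_bool_def)

lemma verts_selector_graph: "verts (selector_graph n k) = {..<Suc (n + 2 * k)}"
  by (simp add: selector_graph_def)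

lemma arcs_ends_selector_graph:
  "arcs_ends (selector_graph n k) =
     {(u, v). u < Suc (n + 2 * k) \<and> v < Suc (n + 2 * k) \<and> selector_adj n u v}"
  by (auto simp: selector_graph_def arcs_ends_def arc_to_ends_def image_iff)

lemma selector_adj_sym: "selector_adj n u v \<Longrightarrow> selector_adj n v u"
  by (auto simp: selector_adj_def)

lemma graph_selector_graph: "graph (selector_graph n k)"
proof -
  let ?N = "Suc (n + 2 * k)"
  have "finite {(u, v). u < ?N \<and> v < ?N \<and> selector_adj n u v}"
    by (rule finite_subset[of _ "{..<?N} \<times> {..<?N}"]) auto
  moreover have "sym (arcs_ends (selector_graph n k))"
    by (auto simp: arcs_ends_selector_graph sym_def selector_adj_sym)
  ultimately show ?thesis
    by unfold_locales
      (auto simp: selector_graph_def arc_to_ends_def symmetric_def selector_adj_def)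
qed

lemma hub_selector_graph:
  assumes "u \<in> verts (selector_graph n k)" "u \<noteq> n"
  shows "(u, n) \<in> arcs_ends (selector_graph n k) \<and> (n, u) \<in> arcs_ends (selector_graph n k)"
  using assms by (auto simp: arcs_ends_selector_graph verts_selector_graph selector_adj_def)

lemma connected_selector_graph: "connected (selector_graph n k)"
proof (rule connected_hub)
  interpret graph "selector_graph n k" by (rule graph_selector_graph)
  show "wf_digraph (selector_graph n k)" by (rule wf_digraph)
  show "n \<in> verts (selector_graph n k)" by (simp add: verts_selector_graph)
qed (rule hub_selector_graph)

lemma gdist_selector_graph:
  assumes "u < Suc (n + 2 * k)" "v < Suc (n + 2 * k)"
  shows "gdist (selector_graph n k) u v =
    (if u = v then 0 else if selector_adj n u v then 1 else 2)"
proof -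
  interpret graph "selector_graph n k" by (rule graph_selector_graph)
  show ?thesis
    using gdist_hub[OF wf_digraph hub_selector_graph, of u v] assms
    by (simp add: verts_selector_graph arcs_ends_selector_graph)
qed

section \<open>Edge queries\<close>

text \<open>Makes \<open>eq\<close> an attained minimum, without which \<open>LEAST\<close> would
  allow no lower bound. The first edge of a shortest path from \<open>x\<close> to \<open>y\<close>
  separates the two.\<close>

lemma ex_edge_strategy: "\<exists>\<sigma> t. locates (selector_graph n k) (arcs_ends (selector_graph n k)) \<sigma> t"
proof (rule ex_locates_if_separating)
  interpret graph "selector_graph n k" by (rule graph_selector_graph)
  show "finite (arcs_ends (selector_graph n k))" by (simp add: arcs_ends_conv)
next
  fix x y
  assume "x \<in> verts (selector_graph n k)" "y \<in> verts (selector_graph n k)" "x \<noteq> y"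
  then have xy: "x < Suc (n + 2 * k)" "y < Suc (n + 2 * k)" "x \<noteq> y"
    by (auto simp: verts_selector_graph)
  \<comment> \<open>\<open>z\<close> is the successor of \<open>x\<close> on a shortest path to \<open>y\<close>\<close>
  define z where "z = (if selector_adj n x y then y else n)"
  have "z < Suc (n + 2 * k)" "selector_adj n x z"
    using xy by (auto simp: z_def selector_adj_def)
  moreover from this have
    "gdist (selector_graph n k) x x < gdist (selector_graph n k) z x"
    "gdist (selector_graph n k) z y < gdist (selector_graph n k) x y"
    using xy by (auto simp: gdist_selector_graph z_def selector_adj_def)
  moreover have "x \<noteq> z" using \<open>selector_adj n x z\<close> by (simp add: selector_adj_def)
  ultimately have "(x, z) \<in> arcs_ends (selector_graph n k)"
    "\<forall>r. \<not> (truthful_reply (selector_graph n k) x (x, z) r \<and>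
       truthful_reply (selector_graph n k) y (x, z) r)"
    using xy by (auto simp: arcs_ends_selector_graph truthful_reply_def)
  then show "\<exists>q \<in> arcs_ends (selector_graph n k).
    \<forall>r. \<not> (truthful_reply (selector_graph n k) x q r \<and> truthful_reply (selector_graph n k) y q r)"
    by blast
qed

text \<open>The hub is at distance 1 from every \<open>y < n\<close>, so only the other endpoint can
  be closer to itself. On an edge from a selector to some \<open>w' < n\<close>, every other
  \<open>y < n\<close> has the maximal distance 2 from \<open>w'\<close>, so replying the selector
  contradicts at most \<open>w'\<close>.\<close>

lemma edge_reply_eliminates_le_1:
  assumes "q \<in> arcs_ends (selector_graph n k)"
  shows "\<exists>r. card {y \<in> {..<n}. \<not> truthful_reply (selector_graph n k) y q r} \<le> 1"
proof -
  let ?G = "selector_graph n k"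
  obtain u v where q: "q = (u, v)" and uv: "u < Suc (n + 2 * k)" "v < Suc (n + 2 * k)"
    and adj: "selector_adj n u v"
    using assms by (auto simp: arcs_ends_selector_graph)
  define good where "good = (\<lambda>w w'. \<forall>y < n. y \<noteq> w' \<longrightarrow> gdist ?G w y \<le> gdist ?G w' y)"
  have hub: "good n w" if "w < Suc (n + 2 * k)" for w
    using that by (auto simp: good_def gdist_selector_graph selector_adj_def)
  have sel: "good w w'" if "selects n w w'" "w < Suc (n + 2 * k)" for w w'
    using that
    by (auto simp: good_def gdist_selector_graph selector_adj_def selects_def selector_def)
  from adj have "good u v \<or> good v u"
    using hub sel uv by (auto simp: selector_adj_def)
  then obtain r w where "\<And>y. \<lbrakk>y < n; y \<noteq> w\<rbrakk> \<Longrightarrow> truthful_reply ?G y q r"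
    by (auto simp: good_def truthful_reply_def q)
  then have "{y \<in> {..<n}. \<not> truthful_reply ?G y q r} \<subseteq> {w}" by auto
  from card_mono[OF _ this] show ?thesis by auto
qed

text \<open>The \<open>n\<close> independent vertices serve as \<open>Y\<close>; the 1 accounts for
  the last remaining candidate.\<close>

lemma le_eq_selector_graph: "n \<le> eq (selector_graph n k) + 1"
proof -
  let ?G = "selector_graph n k"
  have "\<exists>t \<sigma>. locates ?G (arcs_ends ?G) \<sigma> t" using ex_edge_strategy by blast
  then have "\<exists>\<sigma>. locates ?G (arcs_ends ?G) \<sigma> (eq ?G)"
    unfolding eq_def by (rule LeastI_ex)
  then obtain \<sigma> where "locates ?G (arcs_ends ?G) \<sigma> (eq ?G)" by blast
  from locates_imp_card_le[OF this, of "{..<n}"] edge_reply_eliminates_le_1 show ?thesis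
    by (simp add: verts_selector_graph lessThan_subset_iff)
qed

section \<open>Pair queries\<close>

text \<open>If the target is not below \<open>n\<close>, the replies may fit no \<open>x\<close>;
  the choice is then arbitrary, and \<open>champion\<close> forces it into the vertex range.\<close>

definition decode :: "nat \<Rightarrow> nat \<Rightarrow> nat list \<Rightarrow> nat" where
  "decode n k rs = (SOME x. x < n \<and> (\<forall>i < k. rs ! i = selector n i (bit x i)))"

text \<open>The default \<open>0\<close> only serves to keep the queries legal after replies that no target allows.\<close>

definition champion :: "nat \<Rightarrow> nat \<Rightarrow> nat list \<Rightarrow> nat" where
  "champion n k rs =
     (let c = if length rs = k then decode n k rs else last rs
      in if c < Suc (n + 2 * k) then c else 0)"

text \<open>The second phase is a knockout: the winner so far meets the hub and then the selectors
  in turn, and each reply is the new champion.\<close>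

definition pair_strategy :: "nat \<Rightarrow> nat \<Rightarrow> nat strategy" where
  "pair_strategy n k rs =
     (if length rs < k then (selector n (length rs) False, selector n (length rs) True)
      else (champion n k rs, n + (length rs - k)))"

lemma champion_less: "champion n k rs < Suc (n + 2 * k)"
  by (simp add: champion_def Let_def)

text \<open>Only the target itself is at distance 0 from it, so a queried vertex survives only as
  the reply.\<close>

lemma truthful_reply_self:
  assumes "truthful_reply (selector_graph n k) x (u, v) r"
    and "u < Suc (n + 2 * k)" "v < Suc (n + 2 * k)" "x = u \<or> x = v"
  shows "r = x"
  using assms by (auto simp: truthful_reply_def gdist_selector_graph split: if_splits)

text \<open>Exactly one of the two selectors is adjacent to \<open>x\<close>, so there is no
  tie.\<close>

lemma truthful_reply_selectors:
  assumes "truthful_reply (selector_graph n k) x (selector n i False, selector n i True) r"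
    and "x < n" "i < k"
  shows "r = selector n i (bit x i)"
proof -
  have "gdist (selector_graph n k) (selector n i c) x = (if c = bit x i then 1 else 2)" for c
    using assms(2,3) selector_gt[of n i c]
    by (auto simp: gdist_selector_graph selector_less selector_adj_def selects_def selector_eq_iff)
  with assms(1) show ?thesis
    by (cases "bit x i") (auto simp: truthful_reply_def)
qed

lemma eq_if_low_bits_eq:
  fixes x y :: nat
  assumes "x < 2 ^ k" "y < 2 ^ k" and "\<And>i. i < k \<Longrightarrow> bit x i = bit y i"
  shows "x = y"
proof -
  have "take_bit k x = take_bit k y"
    using assms(3) by (auto simp: bit_eq_iff bit_take_bit_iff)
  with assms(1,2) show ?thesis by (simp add: take_bit_nat_eq_self)
qed

text \<open>Invariant of the knockout after \<open>j\<close> duels: a candidate is the champion or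
  has not been challenged yet. The bound on \<open>j\<close> keeps all challengers inside the
  graph.\<close>

lemma candidates_pair_strategy:
  assumes "n \<le> 2 ^ k" "length rs = k + j" "j \<le> 2 * k + 1"
    and "x \<in> candidates (selector_graph n k) (pair_strategy n k) rs"
  shows "x = champion n k rs \<or> n + j \<le> x"
  using assms(2-)
proof (induction j arbitrary: rs)
  case 0
  show ?case
  proof (cases "x < n")
    case True
    have bits: "rs ! i = selector n i (bit x i)" if "i < k" for i
    proof -
      have "truthful_reply (selector_graph n k) x (pair_strategy n k (take i rs)) (rs ! i)"
        using 0 that by (auto simp: candidates_def truthful_replies_def)
      then show ?thesis using truthful_reply_selectors[of n k x i] True that 0
        by (simp add: pair_strategy_def)
    qed
    \<comment> \<open>Numbers below \<open>n \<le> 2 ^ k\<close> are determined by their first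
      \<open>k\<close> bits, so the choice is forced.\<close>
    have "decode n k rs = x" unfolding decode_def
    proof (rule some_equality)
      fix y assume y: "y < n \<and> (\<forall>i<k. rs ! i = selector n i (bit y i))"
      then have "bit y i = bit x i" if "i < k" for i
        using bits that by (metis selector_eq_iff)
      then show "y = x" using y True assms(1) by (intro eq_if_low_bits_eq[of _ k]) auto
    qed (use True bits in auto)
    then show ?thesis using True 0 by (simp add: champion_def)
  qed simp
next
  case (Suc j)
  then obtain rs' r where rs: "rs = rs' @ [r]" by (cases rs rule: rev_exhaust) auto
  with Suc have len: "length rs' = k + j" by simp
  have x: "x \<in> candidates (selector_graph n k) (pair_strategy n k) rs'"
    and r: "truthful_reply (selector_graph n k) x (champion n k rs', n + j) r"
    using Suc.prems len
    by (auto simp: rs candidates_def truthful_replies_snoc pair_strategy_def[of n k rs'])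
  have legal: "n + j < Suc (n + 2 * k)" using Suc.prems by simp
  \<comment> \<open>A truthful reply is one of the two queried vertices, so the default in
    \<open>champion\<close> does not interfere.\<close>
  have "r < Suc (n + 2 * k)"
    using r legal champion_less by (auto simp: truthful_reply_def)
  then have champ: "champion n k rs = r"
    using len by (simp add: champion_def rs)
  from Suc.IH[OF len _ x] Suc.prems have "x = champion n k rs' \<or> n + j \<le> x" by simp
  then consider "x = champion n k rs' \<or> x = n + j" | "n + Suc j \<le> x" by linarith
  then show ?case
    using truthful_reply_self[OF r champion_less legal] champ by cases auto
qed

text \<open>There are \<open>k\<close> bit queries and \<open>2 * k + 1\<close> duels, one for the
  hub and one for each selector; afterwards no unchallenged vertex is left.\<close>

lemma pq_selector_graph_le:
  assumes "n \<le> 2 ^ k"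
  shows "pq (selector_graph n k) \<le> 3 * k + 1"
proof -
  let ?G = "selector_graph n k" and ?\<sigma> = "pair_strategy n k"
  have "locates ?G (verts ?G \<times> verts ?G) ?\<sigma> (3 * k + 1)"
  proof (rule locatesI_unique)
    fix rs :: "nat list" assume "length rs < 3 * k + 1"
    then show "?\<sigma> rs \<in> verts ?G \<times> verts ?G"
      using champion_less[of n k rs]
      by (auto simp: pair_strategy_def verts_selector_graph selector_less)
  next
    fix rs x y
    assume len: "length rs = 3 * k + 1"
      and xy: "x \<in> candidates ?G ?\<sigma> rs" "y \<in> candidates ?G ?\<sigma> rs"
    have "z = champion n k rs" if "z \<in> candidates ?G ?\<sigma> rs" for z
    proof -
      have "z < Suc (n + 2 * k)" using that by (simp add: candidates_def verts_selector_graph)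
      then show ?thesis
        using candidates_pair_strategy[OF assms, of rs "2 * k + 1" z] that len by auto
    qed
    with xy show "x = y" by metis
  qed
  then show ?thesis unfolding pq_def by (blast intro: Least_le)
qed

theorem mainTheorem9:
  shows "\<exists>a b c d :: real. a > 0 \<and> b > 0 \<and> c > 0 \<and> d > 0 \<and>
    (\<forall>n :: nat. n \<ge> 2 \<longrightarrow>
      (\<exists>G :: (nat, nat \<times> nat) pre_digraph.
        graph G \<and> connected G \<and>
        a * real n \<le> real (card (verts G)) \<and> real (card (verts G)) \<le> b * real n \<and>
        real (eq G) \<ge> c * real n \<and>
        real (pq G) \<le> d * ln (real n)))"
proof (rule exI[of _ 1], rule exI[of _ 5], rule exI[of _ "1 / 2"], rule exI[of _ "7 / ln 2"],
    intro conjI allI impI)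
  fix n :: nat assume n: "2 \<le> n"
  \<comment> \<open>\<open>m\<close> is the binary logarithm of \<open>n\<close> rounded down, so
    \<open>m + 1\<close> bits distinguish all numbers below \<open>n\<close>.\<close>
  obtain m where m: "2 ^ m \<le> n" "n < 2 ^ (m + 1)"
    using ex_power_ivl1[of 2 n] n by auto
  let ?G = "selector_graph n (m + 1)"
  have "m < n" using m(1) less_exp[of m] by linarith
  \<comment> \<open>From \<open>m + 1 \<le> n\<close> there are at most \<open>3 * n + 1\<close>
    vertices.\<close>
  then have card: "1 * real n \<le> real (card (verts ?G))" "real (card (verts ?G)) \<le> 5 * real n"
    using n by (auto simp: verts_selector_graph)
  \<comment> \<open>\<open>n - 1\<close> is at least half of \<open>n\<close> because
    \<open>n\<close> is at least 2.\<close>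
  have eq: "1 / 2 * real n \<le> real (eq ?G)"
    using le_eq_selector_graph[of n "m + 1"] n by linarith
  have "real m * ln 2 = ln (2 ^ m)" by (simp add: ln_realpow)
  also have "\<dots> = ln (real (2 ^ m))" by simp
  also have "\<dots> \<le> ln (real n)"
    using m(1) by (intro ln_mono) (simp_all only: of_nat_le_iff of_nat_0_less_iff, simp_all)
  finally have "real m * ln 2 \<le> ln (real n)" .
  moreover have "ln 2 \<le> ln (real n)" using n by simp
  moreover have "pq ?G \<le> 3 * m + 4" using pq_selector_graph_le[of n "m + 1"] m(2) by simp
  then have "real (pq ?G) * ln 2 \<le> (3 * real m + 4) * ln 2"
    by (intro mult_right_mono) auto
  \<comment> \<open>The 7 is 3 + 4: \<open>3 * m\<close> is charged to
    \<open>m * ln 2 \<le> ln n\<close>, the constant 4 to \<open>ln 2 \<le> ln n\<close>.\<close>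
  ultimately have "real (pq ?G) * ln 2 \<le> 7 * ln (real n)" by (simp add: algebra_simps)
  then have "real (pq ?G) \<le> 7 / ln 2 * ln (real n)" by (simp add: field_simps)
  with card eq show "\<exists>G :: (nat, nat \<times> nat) pre_digraph.
        graph G \<and> connected G \<and>
        1 * real n \<le> real (card (verts G)) \<and> real (card (verts G)) \<le> 5 * real n \<and>
        real (eq G) \<ge> 1 / 2 * real n \<and>
        real (pq G) \<le> 7 / ln 2 * ln (real n)"
    using graph_selector_graph connected_selector_graph by blast
qed simp_all

end
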